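(* Let $\mathcal{T}$ be a rigidly-compactly generated tt-category, let $(\mathcal{S}_i)_{i\in\mathcal{I}}$ be a family of rigidly-compactly generated tt-categories indexed by a set $\mathcal{I}$, and let $(f_i^\ast\colon \mathcal{T}\to \mathcal{S}_i)_{i\in \mathcal{I}}$ be a family of geometric functors. If the family $(f_i^\ast)_{i\in\mathcal{I}}$ is pure descendable, then it is jointly conservative; that is, for any object $x\in\mathcal{T}$ one has $x\simeq 0$ if and only if $f_i^\ast(x)\simeq 0$ for all $i\in\mathcal{I}$.
   Context: Conventions: all triangulated categories and exact functors between them are assumed to arise from stable $\infty$-categories. A rigidly-compactly generated tt-category is a triple $(\mathcal{T},\otimes,\mathbb{1})$ where $\mathcal{T}$ is a compactly generated triangulated category with a symmetric monoidal structure $(\otimes,\mathbb{1})$ such that $\otimes$ preserves coproducts in each variable, $\mathbb{1}$ is compact, and every compact object is dualizable. A geometric functor $f^\ast\colon\mathcal{T}\to\mathcal{S}$ between such categories is a strongly monoidal triangulated functor that preserves small coproducts; it has a right adjoint $f_\ast$ (which itself has a right adjoint), and we write $f_\ast\mathcal{S}$ for the essential image of $f_\ast$. A map $g\colon x\to y$ in $\mathcal{T}$ is a pure monomorphism if $\mathcal{T}(c,x)\to\mathcal{T}(c,y)$ is injective for every compact object $c\in\mathcal{T}$, where $\mathcal{T}(-,-)$ denotes the group of morphisms in the homotopy category; then $x$ is called a pure subobject of $y$. For a class $\mathcal{X}$ of objects of $\mathcal{T}$: $\mathbf{pure}(\mathcal{X})$ is the closure of $\mathcal{X}$ under pure subobjects;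 $\mathbf{prod}(\mathcal{X})$ is the closure of $\mathcal{X}$ under (set-indexed) products; $\mathrm{Thick}(\mathcal{X})$ is the smallest thick subcategory containing $\mathcal{X}$; and $\mathbf{pure}^\Delta_\Pi(\mathcal{X}):=\mathbf{pure}(\mathrm{Thick}(\mathbf{prod}(\mathcal{X})))$. The family $(f_i^\ast)_{i\in\mathcal{I}}$ is pure descendable if $\mathbf{pure}^\Delta_\Pi\left(\bigcup_{i\in\mathcal{I}}(f_i)_\ast\mathcal{S}_i\right)=\mathcal{T}$; equivalently, if $\mathcal{P}:=\mathbf{pure}^\Delta_\Pi\left(\bigcup_{i\in\mathcal{I}}(f_i)_\ast\mathcal{S}_i\right)$ is a tensor-ideal (i.e. $\mathcal{T}\otimes\mathcal{P}\subseteq\mathcal{P}$) containing the monoidal unit $\mathbb{1}_{\mathcal{T}}$. *)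

theory Defs
  imports "HOL-Algebra.Product_Groups" "HOL-Algebra.FiniteProduct" "HOL-Library.Equipollence"
begin

section \<open>Smallness\<close>

text \<open>
  \<open>U\<close> plays the role of a Grothendieck universe, and a set is \<open>U\<close>-small if it has strictly
  smaller cardinality than \<open>U\<close>. For a Grothendieck universe \<open>U\<close> the small sets are exactly the sets
  equipollent to an element of \<open>U\<close>. Small (co)products are indexed by small subsets of \<open>U\<close>; every
  small set is equipollent to one of these, so no small index set is lost. The definitions make sense
  for every set \<open>U\<close>, so no closure properties of \<open>U\<close> are imposed.
\<close>

definition small :: "'u set \<Rightarrow> 'a set \<Rightarrow> bool"
  where "small U A \<longleftrightarrow> A \<prec> U"


section \<open>Categories and functors\<close>

record ('o, 'm) category =
  Ob :: "'o set"
  Arr :: "'m set"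
  Dom :: "'m \<Rightarrow> 'o"
  Cod :: "'m \<Rightarrow> 'o"
  Ident :: "'o \<Rightarrow> 'm"
  Comp :: "'m \<Rightarrow> 'm \<Rightarrow> 'm"  (infixl "\<cdot>\<index>" 70)

definition Hom :: "('o, 'm, 'z) category_scheme \<Rightarrow> 'o \<Rightarrow> 'o \<Rightarrow> 'm set"
  where "Hom C a b = {f \<in> Arr C. Dom C f = a \<and> Cod C f = b}"

locale category =
  fixes C :: "('o, 'm, 'z) category_scheme" (structure)
  assumes Dom_Ob: "f \<in> Arr C \<Longrightarrow> Dom C f \<in> Ob C"
    and Cod_Ob: "f \<in> Arr C \<Longrightarrow> Cod C f \<in> Ob C"
    and Ident_Hom: "a \<in> Ob C \<Longrightarrow> Ident C a \<in> Hom C a a"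
    and Comp_Hom: "f \<in> Hom C a b \<Longrightarrow> g \<in> Hom C b c \<Longrightarrow> g \<cdot> f \<in> Hom C a c"
    and Ident_left: "f \<in> Hom C a b \<Longrightarrow> Ident C b \<cdot> f = f"
    and Ident_right: "f \<in> Hom C a b \<Longrightarrow> f \<cdot> Ident C a = f"
    and Comp_assoc: "f \<in> Hom C a b \<Longrightarrow> g \<in> Hom C b c \<Longrightarrow> h \<in> Hom C c d \<Longrightarrow>
      h \<cdot> (g \<cdot> f) = (h \<cdot> g) \<cdot> f"

definition Iso :: "('o, 'm, 'z) category_scheme \<Rightarrow> 'o \<Rightarrow> 'o \<Rightarrow> 'm set"
  where "Iso C a b = {f \<in> Hom C a b.
    \<exists>g \<in> Hom C b a. g \<cdot>\<^bsub>C\<^esub> f = Ident C a \<and> f \<cdot>\<^bsub>C\<^esub> g = Ident C b}"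

definition inverse_arr :: "('o, 'm, 'z) category_scheme \<Rightarrow> 'm \<Rightarrow> 'm"
  where "inverse_arr C f = (THE g. g \<in> Hom C (Cod C f) (Dom C f) \<and>
    g \<cdot>\<^bsub>C\<^esub> f = Ident C (Dom C f) \<and> f \<cdot>\<^bsub>C\<^esub> g = Ident C (Cod C f))"

definition isomorphic :: "('o, 'm, 'z) category_scheme \<Rightarrow> 'o \<Rightarrow> 'o \<Rightarrow> bool"
  where "isomorphic C a b \<longleftrightarrow> Iso C a b \<noteq> {}"

definition zero_object :: "('o, 'm, 'z) category_scheme \<Rightarrow> 'o \<Rightarrow> bool"
  where "zero_object C z \<longleftrightarrow> z \<in> Ob C \<and>
    (\<forall>x \<in> Ob C. (\<exists>!f. f \<in> Hom C z x) \<and> (\<exists>!f. f \<in> Hom C x z))"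

definition is_coproduct ::
    "('o, 'm, 'z) category_scheme \<Rightarrow> 'k set \<Rightarrow> ('k \<Rightarrow> 'o) \<Rightarrow> 'o \<Rightarrow> ('k \<Rightarrow> 'm) \<Rightarrow> bool"
  where "is_coproduct C K x s \<iota> \<longleftrightarrow>
    s \<in> Ob C \<and> (\<forall>k \<in> K. x k \<in> Ob C \<and> \<iota> k \<in> Hom C (x k) s) \<and>
    (\<forall>y \<in> Ob C. \<forall>f. (\<forall>k \<in> K. f k \<in> Hom C (x k) y) \<longrightarrow>
      (\<exists>!h. h \<in> Hom C s y \<and> (\<forall>k \<in> K. h \<cdot>\<^bsub>C\<^esub> \<iota> k = f k)))"

definition is_product ::
    "('o, 'm, 'z) category_scheme \<Rightarrow> 'k set \<Rightarrow> ('k \<Rightarrow> 'o) \<Rightarrow> 'o \<Rightarrow> ('k \<Rightarrow> 'm) \<Rightarrow> bool"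
  where "is_product C K x p \<pi> \<longleftrightarrow>
    p \<in> Ob C \<and> (\<forall>k \<in> K. x k \<in> Ob C \<and> \<pi> k \<in> Hom C p (x k)) \<and>
    (\<forall>y \<in> Ob C. \<forall>f. (\<forall>k \<in> K. f k \<in> Hom C y (x k)) \<longrightarrow>
      (\<exists>!h. h \<in> Hom C y p \<and> (\<forall>k \<in> K. \<pi> k \<cdot>\<^bsub>C\<^esub> h = f k)))"

record ('o, 'm, 'p, 'n) cfunctor =
  FO :: "'o \<Rightarrow> 'p"
  FA :: "'m \<Rightarrow> 'n"

definition is_functor ::
    "('o, 'm, 'z) category_scheme \<Rightarrow> ('p, 'n, 'y) category_scheme \<Rightarrow>
     ('o, 'm, 'p, 'n) cfunctor \<Rightarrow> bool"
  where "is_functor C D F \<longleftrightarrow>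
    (\<forall>a \<in> Ob C. FO F a \<in> Ob D \<and> FA F (Ident C a) = Ident D (FO F a)) \<and>
    (\<forall>a b f. f \<in> Hom C a b \<longrightarrow> FA F f \<in> Hom D (FO F a) (FO F b)) \<and>
    (\<forall>a b c f g. f \<in> Hom C a b \<longrightarrow> g \<in> Hom C b c \<longrightarrow>
      FA F (g \<cdot>\<^bsub>C\<^esub> f) = FA F g \<cdot>\<^bsub>D\<^esub> FA F f)"

definition is_equivalence ::
    "('o, 'm, 'z) category_scheme \<Rightarrow> ('p, 'n, 'y) category_scheme \<Rightarrow>
     ('o, 'm, 'p, 'n) cfunctor \<Rightarrow> bool"
  where "is_equivalence C D F \<longleftrightarrow> is_functor C D F \<and>
    (\<forall>a \<in> Ob C. \<forall>b \<in> Ob C. bij_betw (FA F) (Hom C a b) (Hom D (FO F a) (FO F b))) \<and>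
    (\<forall>y \<in> Ob D. \<exists>x \<in> Ob C. isomorphic D (FO F x) y)"

text \<open>\<open>right_adjoint C D F R\<close>: the functor \<open>R : D \<rightarrow> C\<close> is right adjoint to \<open>F : C \<rightarrow> D\<close>.\<close>

definition right_adjoint ::
    "('o, 'm, 'z) category_scheme \<Rightarrow> ('p, 'n, 'y) category_scheme \<Rightarrow>
     ('o, 'm, 'p, 'n) cfunctor \<Rightarrow> ('p, 'n, 'o, 'm) cfunctor \<Rightarrow> bool"
  where "right_adjoint C D F R \<longleftrightarrow> is_functor D C R \<and>
    (\<exists>\<phi>. (\<forall>a \<in> Ob C. \<forall>b \<in> Ob D. bij_betw (\<phi> a b) (Hom D (FO F a) b) (Hom C a (FO R b))) \<and>
      (\<forall>a a' b b' f g h. f \<in> Hom C a' a \<longrightarrow> g \<in> Hom D b b' \<longrightarrow> h \<in> Hom D (FO F a) b \<longrightarrow>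
        \<phi> a' b' (g \<cdot>\<^bsub>D\<^esub> h \<cdot>\<^bsub>D\<^esub> FA F f) = FA R g \<cdot>\<^bsub>C\<^esub> \<phi> a b h \<cdot>\<^bsub>C\<^esub> f))"

definition essential_image ::
    "('o, 'm, 'z) category_scheme \<Rightarrow> ('p, 'n, 'y) category_scheme \<Rightarrow>
     ('o, 'm, 'p, 'n) cfunctor \<Rightarrow> 'p set"
  where "essential_image C D F = {y \<in> Ob D. \<exists>x \<in> Ob C. isomorphic D (FO F x) y}"

definition preserves_coproducts ::
    "'u set \<Rightarrow> ('o, 'm, 'z) category_scheme \<Rightarrow> ('p, 'n, 'y) category_scheme \<Rightarrow>
     ('o, 'm, 'p, 'n) cfunctor \<Rightarrow> bool"
  where "preserves_coproducts U C D F \<longleftrightarrow>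
    (\<forall>K x s \<iota>. K \<subseteq> U \<longrightarrow> small U K \<longrightarrow> is_coproduct C K x s \<iota> \<longrightarrow>
      is_coproduct D K (\<lambda>k. FO F (x k)) (FO F s) (\<lambda>k. FA F (\<iota> k)))"


section \<open>Additive categories\<close>

record ('o, 'm) preadditive = "('o, 'm) category" +
  ZeroA :: "'o \<Rightarrow> 'o \<Rightarrow> 'm"
  AddA :: "'m \<Rightarrow> 'm \<Rightarrow> 'm"  (infixl "\<^bold>+\<index>" 65)

definition hom_group :: "('o, 'm, 'z) preadditive_scheme \<Rightarrow> 'o \<Rightarrow> 'o \<Rightarrow> 'm monoid"
  where "hom_group A a b = \<lparr>carrier = Hom A a b, mult = AddA A, one = ZeroA A a b\<rparr>"

locale additive_category = category A for A :: "('o, 'm, 'z) preadditive_scheme" (structure) +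
  assumes hom_comm_group: "a \<in> Ob A \<Longrightarrow> b \<in> Ob A \<Longrightarrow> comm_group (hom_group A a b)"
    and Comp_add_left: "f \<in> Hom A a b \<Longrightarrow> g \<in> Hom A b c \<Longrightarrow> g' \<in> Hom A b c \<Longrightarrow>
      (g \<^bold>+ g') \<cdot> f = (g \<cdot> f) \<^bold>+ (g' \<cdot> f)"
    and Comp_add_right: "f \<in> Hom A a b \<Longrightarrow> f' \<in> Hom A a b \<Longrightarrow> g \<in> Hom A b c \<Longrightarrow>
      g \<cdot> (f \<^bold>+ f') = (g \<cdot> f) \<^bold>+ (g \<cdot> f')"
    and zero_object_exists: "\<exists>z. zero_object A z"
    and biproduct_exists: "a \<in> Ob A \<Longrightarrow> b \<in> Ob A \<Longrightarrow>
      \<exists>s \<in> Ob A. \<exists>i \<in> Hom A a s. \<exists>j \<in> Hom A b s. \<exists>p \<in> Hom A s a. \<exists>q \<in> Hom A s b.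
        p \<cdot> i = Ident A a \<and> q \<cdot> j = Ident A b \<and> p \<cdot> j = ZeroA A b a \<and> q \<cdot> i = ZeroA A a b \<and>
        (i \<cdot> p) \<^bold>+ (j \<cdot> q) = Ident A s"

definition additive_functor ::
    "('o, 'm, 'z) preadditive_scheme \<Rightarrow> ('p, 'n, 'y) preadditive_scheme \<Rightarrow>
     ('o, 'm, 'p, 'n) cfunctor \<Rightarrow> bool"
  where "additive_functor C D F \<longleftrightarrow> is_functor C D F \<and>
    (\<forall>a b f g. f \<in> Hom C a b \<longrightarrow> g \<in> Hom C a b \<longrightarrow>
      FA F (f \<^bold>+\<^bsub>C\<^esub> g) = FA F f \<^bold>+\<^bsub>D\<^esub> FA F g)"

text \<open>
  \<open>c\<close> is compact if the canonical map from the direct sum of the groups \<open>Hom(c, x\<^sub>k)\<close> to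
  \<open>Hom(c, \<Coprod>\<^sub>k x\<^sub>k)\<close> is an isomorphism for all small coproducts. The groups \<open>hom_group\<close> are written
  multiplicatively in the library, so \<open>finprod\<close> is the sum of morphisms.
\<close>

definition compact_object :: "'u set \<Rightarrow> ('o, 'm, 'z) preadditive_scheme \<Rightarrow> 'o \<Rightarrow> bool"
  where "compact_object U A c \<longleftrightarrow> c \<in> Ob A \<and>
    (\<forall>K x s \<iota>. K \<subseteq> U \<longrightarrow> small U K \<longrightarrow> is_coproduct A K x s \<iota> \<longrightarrow>
      (\<lambda>g. finprod (hom_group A c s) (\<lambda>k. \<iota> k \<cdot>\<^bsub>A\<^esub> g k) {k \<in> K. g k \<noteq> ZeroA A c (x k)})
        \<in> iso (sum_group K (\<lambda>k. hom_group A c (x k))) (hom_group A c s))"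


section \<open>Triangulated categories\<close>

text \<open>
  A triple \<open>(f, g, h) \<in> Tri T\<close> stands for the distinguished triangle
  \<open>x \<rightarrow> y \<rightarrow> z \<rightarrow> \<Sigma> x\<close> with these three maps. The shift is an equivalence, not necessarily an
  automorphism.
\<close>

record ('o, 'm) triangulated = "('o, 'm) preadditive" +
  Shift :: "('o, 'm, 'o, 'm) cfunctor"
  Tri :: "('m \<times> 'm \<times> 'm) set"

definition triangle ::
    "('o, 'm, 'z) triangulated_scheme \<Rightarrow> 'o \<Rightarrow> 'o \<Rightarrow> 'o \<Rightarrow> 'm \<Rightarrow> 'm \<Rightarrow> 'm \<Rightarrow> bool"
  where "triangle T x y z f g h \<longleftrightarrow>
    f \<in> Hom T x y \<and> g \<in> Hom T y z \<and> h \<in> Hom T z (FO (Shift T) x)"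

definition dist_triangle ::
    "('o, 'm, 'z) triangulated_scheme \<Rightarrow> 'o \<Rightarrow> 'o \<Rightarrow> 'o \<Rightarrow> 'm \<Rightarrow> 'm \<Rightarrow> 'm \<Rightarrow> bool"
  where "dist_triangle T x y z f g h \<longleftrightarrow> triangle T x y z f g h \<and> (f, g, h) \<in> Tri T"

locale triangulated_category = additive_category T
  for T :: "('o, 'm, 'z) triangulated_scheme" (structure) +
  assumes shift_equivalence: "is_equivalence T T (Shift T)"
    and shift_additive: "additive_functor T T (Shift T)"
    and Tri_triangle: "(f, g, h) \<in> Tri T \<Longrightarrow> \<exists>x y z. triangle T x y z f g h"
    and TR1_cone: "f \<in> Hom T x y \<Longrightarrow> \<exists>z g h. dist_triangle T x y z f g h"
    and TR1_ident: "x \<in> Ob T \<Longrightarrow> zero_object T z \<Longrightarrow>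
      dist_triangle T x x z (Ident T x) (ZeroA T x z) (ZeroA T z (FO (Shift T) x))"
    and TR1_iso: "dist_triangle T x y z f g h \<Longrightarrow> triangle T x' y' z' f' g' h' \<Longrightarrow>
      a \<in> Iso T x x' \<Longrightarrow> b \<in> Iso T y y' \<Longrightarrow> c \<in> Iso T z z' \<Longrightarrow>
      f' \<cdot> a = b \<cdot> f \<Longrightarrow> g' \<cdot> b = c \<cdot> g \<Longrightarrow> h' \<cdot> c = FA (Shift T) a \<cdot> h \<Longrightarrow>
      dist_triangle T x' y' z' f' g' h'"
    and TR2: "triangle T x y z f g h \<Longrightarrow>
      dist_triangle T x y z f g h \<longleftrightarrow>
      dist_triangle T y z (FO (Shift T) x) g h
        (inv\<^bsub>hom_group T (FO (Shift T) x) (FO (Shift T) y)\<^esub> (FA (Shift T) f))"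
    and TR3: "dist_triangle T x y z f g h \<Longrightarrow> dist_triangle T x' y' z' f' g' h' \<Longrightarrow>
      a \<in> Hom T x x' \<Longrightarrow> b \<in> Hom T y y' \<Longrightarrow> f' \<cdot> a = b \<cdot> f \<Longrightarrow>
      \<exists>c \<in> Hom T z z'. g' \<cdot> b = c \<cdot> g \<and> h' \<cdot> c = FA (Shift T) a \<cdot> h"
    and TR4: "dist_triangle T x y u f f' f'' \<Longrightarrow> dist_triangle T y z w g g' g'' \<Longrightarrow>
      dist_triangle T x z v (g \<cdot> f) h' h'' \<Longrightarrow>
      \<exists>p q r. dist_triangle T u v w p q r \<and>
        p \<cdot> f' = h' \<cdot> g \<and> h'' \<cdot> p = f'' \<and> q \<cdot> h' = g' \<and>
        g'' \<cdot> q = FA (Shift T) f \<cdot> h'' \<and> r = FA (Shift T) f' \<cdot> g''"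

definition exact_functor ::
    "('o, 'm, 'z) triangulated_scheme \<Rightarrow> ('p, 'n, 'y) triangulated_scheme \<Rightarrow>
     ('o, 'm, 'p, 'n) cfunctor \<Rightarrow> bool"
  where "exact_functor C D F \<longleftrightarrow> additive_functor C D F \<and>
    (\<exists>\<theta>. (\<forall>a \<in> Ob C. \<theta> a \<in> Iso D (FO F (FO (Shift C) a)) (FO (Shift D) (FO F a))) \<and>
      (\<forall>a b f. f \<in> Hom C a b \<longrightarrow>
        FA (Shift D) (FA F f) \<cdot>\<^bsub>D\<^esub> \<theta> a = \<theta> b \<cdot>\<^bsub>D\<^esub> FA F (FA (Shift C) f)) \<and>
      (\<forall>x y z f g h. dist_triangle C x y z f g h \<longrightarrow>
        dist_triangle D (FO F x) (FO F y) (FO F z) (FA F f) (FA F g) (\<theta> x \<cdot>\<^bsub>D\<^esub> FA F h)))"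

definition thick_subcategory :: "('o, 'm, 'z) triangulated_scheme \<Rightarrow> 'o set \<Rightarrow> bool"
  where "thick_subcategory T P \<longleftrightarrow> P \<subseteq> Ob T \<and>
    (\<forall>z. zero_object T z \<longrightarrow> z \<in> P) \<and>
    (\<forall>x \<in> Ob T. FO (Shift T) x \<in> P \<longleftrightarrow> x \<in> P) \<and>
    (\<forall>x y z f g h. dist_triangle T x y z f g h \<longrightarrow>
      (x \<in> P \<and> y \<in> P \<longrightarrow> z \<in> P) \<and> (y \<in> P \<and> z \<in> P \<longrightarrow> x \<in> P) \<and> (x \<in> P \<and> z \<in> P \<longrightarrow> y \<in> P)) \<and>
    (\<forall>x \<in> Ob T. \<forall>y \<in> P. \<forall>i \<in> Hom T x y. \<forall>r \<in> Hom T y x.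
      r \<cdot>\<^bsub>T\<^esub> i = Ident T x \<longrightarrow> x \<in> P)"

definition Thick :: "('o, 'm, 'z) triangulated_scheme \<Rightarrow> 'o set \<Rightarrow> 'o set"
  where "Thick T X = \<Inter>{P. thick_subcategory T P \<and> X \<subseteq> P}"

text \<open>
  The generation clause says that \<open>Hom(\<Sigma>\<^sup>n g, x) = 0\<close> for all \<open>g \<in> G\<close> and all integers \<open>n\<close> forces
  \<open>x = 0\<close>; negative shifts are moved to the other argument since \<open>\<Sigma>\<close> is only an equivalence.
\<close>

definition compactly_generated :: "'u set \<Rightarrow> ('o, 'm, 'z) triangulated_scheme \<Rightarrow> bool"
  where "compactly_generated U T \<longleftrightarrow>
    (\<forall>a \<in> Ob T. \<forall>b \<in> Ob T. small U (Hom T a b)) \<and>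
    (\<forall>K x. K \<subseteq> U \<longrightarrow> small U K \<longrightarrow> (\<forall>k \<in> K. x k \<in> Ob T) \<longrightarrow> (\<exists>s \<iota>. is_coproduct T K x s \<iota>)) \<and>
    (\<exists>G. small U G \<and> (\<forall>g \<in> G. compact_object U T g) \<and>
      (\<forall>x \<in> Ob T.
        (\<forall>g \<in> G. \<forall>n :: nat.
          Hom T ((FO (Shift T) ^^ n) g) x = {ZeroA T ((FO (Shift T) ^^ n) g) x} \<and>
          Hom T g ((FO (Shift T) ^^ n) x) = {ZeroA T g ((FO (Shift T) ^^ n) x)})
        \<longrightarrow> zero_object T x))"


section \<open>Tensor-triangulated categories\<close>

record ('o, 'm) ttcat = "('o, 'm) triangulated" +
  TensO :: "'o \<Rightarrow> 'o \<Rightarrow> 'o"  (infixl "\<otimes>\<^sub>o\<index>" 75)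
  TensA :: "'m \<Rightarrow> 'm \<Rightarrow> 'm"  (infixl "\<otimes>\<^sub>a\<index>" 75)
  UnitO :: 'o
  Assoc :: "'o \<Rightarrow> 'o \<Rightarrow> 'o \<Rightarrow> 'm"
  LUnit :: "'o \<Rightarrow> 'm"
  RUnit :: "'o \<Rightarrow> 'm"
  Braid :: "'o \<Rightarrow> 'o \<Rightarrow> 'm"

locale symmetric_monoidal_category = category T
  for T :: "('o, 'm, 'z) ttcat_scheme" (structure) +
  assumes TensO_Ob: "a \<in> Ob T \<Longrightarrow> b \<in> Ob T \<Longrightarrow> a \<otimes>\<^sub>o b \<in> Ob T"
    and UnitO_Ob: "UnitO T \<in> Ob T"
    and TensA_Hom: "f \<in> Hom T a b \<Longrightarrow> g \<in> Hom T c d \<Longrightarrow> f \<otimes>\<^sub>a g \<in> Hom T (a \<otimes>\<^sub>o c) (b \<otimes>\<^sub>o d)"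
    and TensA_Ident: "a \<in> Ob T \<Longrightarrow> b \<in> Ob T \<Longrightarrow> Ident T a \<otimes>\<^sub>a Ident T b = Ident T (a \<otimes>\<^sub>o b)"
    and TensA_Comp: "f \<in> Hom T a b \<Longrightarrow> f' \<in> Hom T b c \<Longrightarrow> g \<in> Hom T a' b' \<Longrightarrow> g' \<in> Hom T b' c' \<Longrightarrow>
      (f' \<cdot> f) \<otimes>\<^sub>a (g' \<cdot> g) = (f' \<otimes>\<^sub>a g') \<cdot> (f \<otimes>\<^sub>a g)"
    and Assoc_Iso: "a \<in> Ob T \<Longrightarrow> b \<in> Ob T \<Longrightarrow> c \<in> Ob T \<Longrightarrow>
      Assoc T a b c \<in> Iso T ((a \<otimes>\<^sub>o b) \<otimes>\<^sub>o c) (a \<otimes>\<^sub>o (b \<otimes>\<^sub>o c))"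
    and LUnit_Iso: "a \<in> Ob T \<Longrightarrow> LUnit T a \<in> Iso T (UnitO T \<otimes>\<^sub>o a) a"
    and RUnit_Iso: "a \<in> Ob T \<Longrightarrow> RUnit T a \<in> Iso T (a \<otimes>\<^sub>o UnitO T) a"
    and Braid_Iso: "a \<in> Ob T \<Longrightarrow> b \<in> Ob T \<Longrightarrow> Braid T a b \<in> Iso T (a \<otimes>\<^sub>o b) (b \<otimes>\<^sub>o a)"
    and Assoc_natural: "f \<in> Hom T a a' \<Longrightarrow> g \<in> Hom T b b' \<Longrightarrow> h \<in> Hom T c c' \<Longrightarrow>
      Assoc T a' b' c' \<cdot> ((f \<otimes>\<^sub>a g) \<otimes>\<^sub>a h) = (f \<otimes>\<^sub>a (g \<otimes>\<^sub>a h)) \<cdot> Assoc T a b c"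
    and LUnit_natural: "f \<in> Hom T a b \<Longrightarrow>
      LUnit T b \<cdot> (Ident T (UnitO T) \<otimes>\<^sub>a f) = f \<cdot> LUnit T a"
    and RUnit_natural: "f \<in> Hom T a b \<Longrightarrow>
      RUnit T b \<cdot> (f \<otimes>\<^sub>a Ident T (UnitO T)) = f \<cdot> RUnit T a"
    and Braid_natural: "f \<in> Hom T a a' \<Longrightarrow> g \<in> Hom T b b' \<Longrightarrow>
      Braid T a' b' \<cdot> (f \<otimes>\<^sub>a g) = (g \<otimes>\<^sub>a f) \<cdot> Braid T a b"
    and unit_triangle: "a \<in> Ob T \<Longrightarrow> b \<in> Ob T \<Longrightarrow>
      (Ident T a \<otimes>\<^sub>a LUnit T b) \<cdot> Assoc T a (UnitO T) b = RUnit T a \<otimes>\<^sub>a Ident T b"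
    and pentagon: "a \<in> Ob T \<Longrightarrow> b \<in> Ob T \<Longrightarrow> c \<in> Ob T \<Longrightarrow> d \<in> Ob T \<Longrightarrow>
      Assoc T a b (c \<otimes>\<^sub>o d) \<cdot> Assoc T (a \<otimes>\<^sub>o b) c d =
      (Ident T a \<otimes>\<^sub>a Assoc T b c d) \<cdot> Assoc T a (b \<otimes>\<^sub>o c) d \<cdot> (Assoc T a b c \<otimes>\<^sub>a Ident T d)"
    and hexagon: "a \<in> Ob T \<Longrightarrow> b \<in> Ob T \<Longrightarrow> c \<in> Ob T \<Longrightarrow>
      Assoc T b c a \<cdot> Braid T a (b \<otimes>\<^sub>o c) \<cdot> Assoc T a b c =
      (Ident T b \<otimes>\<^sub>a Braid T a c) \<cdot> Assoc T b a c \<cdot> (Braid T a b \<otimes>\<^sub>a Ident T c)"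
    and Braid_symmetric: "a \<in> Ob T \<Longrightarrow> b \<in> Ob T \<Longrightarrow>
      Braid T b a \<cdot> Braid T a b = Ident T (a \<otimes>\<^sub>o b)"

definition tensor_right :: "('o, 'm, 'z) ttcat_scheme \<Rightarrow> 'o \<Rightarrow> ('o, 'm, 'o, 'm) cfunctor"
  where "tensor_right T y =
    \<lparr>FO = (\<lambda>x. x \<otimes>\<^sub>o\<^bsub>T\<^esub> y), FA = (\<lambda>f. f \<otimes>\<^sub>a\<^bsub>T\<^esub> Ident T y)\<rparr>"

definition tensor_left :: "('o, 'm, 'z) ttcat_scheme \<Rightarrow> 'o \<Rightarrow> ('o, 'm, 'o, 'm) cfunctor"
  where "tensor_left T y =
    \<lparr>FO = (\<lambda>x. y \<otimes>\<^sub>o\<^bsub>T\<^esub> x), FA = (\<lambda>f. Ident T y \<otimes>\<^sub>a\<^bsub>T\<^esub> f)\<rparr>"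

definition dualizable :: "('o, 'm, 'z) ttcat_scheme \<Rightarrow> 'o \<Rightarrow> bool"
  where "dualizable T x \<longleftrightarrow> x \<in> Ob T \<and>
    (\<exists>d \<in> Ob T. \<exists>ev \<in> Hom T (d \<otimes>\<^sub>o\<^bsub>T\<^esub> x) (UnitO T). \<exists>coev \<in> Hom T (UnitO T) (x \<otimes>\<^sub>o\<^bsub>T\<^esub> d).
      RUnit T x \<cdot>\<^bsub>T\<^esub> (Ident T x \<otimes>\<^sub>a\<^bsub>T\<^esub> ev) \<cdot>\<^bsub>T\<^esub> Assoc T x d x \<cdot>\<^bsub>T\<^esub> (coev \<otimes>\<^sub>a\<^bsub>T\<^esub> Ident T x)
        = LUnit T x \<and>
      LUnit T d \<cdot>\<^bsub>T\<^esub> (ev \<otimes>\<^sub>a\<^bsub>T\<^esub> Ident T d) \<cdot>\<^bsub>T\<^esub> inverse_arr T (Assoc T d x d) \<cdot>\<^bsub>T\<^esub>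
          (Ident T d \<otimes>\<^sub>a\<^bsub>T\<^esub> coev)
        = RUnit T d)"

text \<open>
  The tensor product is exact in each variable, as the prefix tt demands. No stable
  \<open>\<infinity>\<close>-categorical enhancement is required.
\<close>

definition rigidly_compactly_generated :: "'u set \<Rightarrow> ('o, 'm, 'z) ttcat_scheme \<Rightarrow> bool"
  where "rigidly_compactly_generated U T \<longleftrightarrow>
    triangulated_category T \<and> compactly_generated U T \<and> symmetric_monoidal_category T \<and>
    (\<forall>y \<in> Ob T. exact_functor T T (tensor_right T y) \<and> exact_functor T T (tensor_left T y) \<and>
      preserves_coproducts U T T (tensor_right T y) \<and>
      preserves_coproducts U T T (tensor_left T y)) \<and>
    compact_object U T (UnitO T) \<and>
    (\<forall>c. compact_object U T c \<longrightarrow> dualizable T c)"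

definition strong_monoidal_functor ::
    "('o, 'm, 'z) ttcat_scheme \<Rightarrow> ('p, 'n, 'y) ttcat_scheme \<Rightarrow>
     ('o, 'm, 'p, 'n) cfunctor \<Rightarrow> bool"
  where "strong_monoidal_functor T S F \<longleftrightarrow> is_functor T S F \<and>
    (\<exists>\<mu> \<eta>. \<eta> \<in> Iso S (UnitO S) (FO F (UnitO T)) \<and>
      (\<forall>a \<in> Ob T. \<forall>b \<in> Ob T. \<mu> a b \<in> Iso S (FO F a \<otimes>\<^sub>o\<^bsub>S\<^esub> FO F b) (FO F (a \<otimes>\<^sub>o\<^bsub>T\<^esub> b))) \<and>
      (\<forall>a a' b b' f g. f \<in> Hom T a a' \<longrightarrow> g \<in> Hom T b b' \<longrightarrow>
        FA F (f \<otimes>\<^sub>a\<^bsub>T\<^esub> g) \<cdot>\<^bsub>S\<^esub> \<mu> a b = \<mu> a' b' \<cdot>\<^bsub>S\<^esub> (FA F f \<otimes>\<^sub>a\<^bsub>S\<^esub> FA F g)) \<and>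
      (\<forall>a \<in> Ob T. \<forall>b \<in> Ob T. \<forall>c \<in> Ob T.
        FA F (Assoc T a b c) \<cdot>\<^bsub>S\<^esub> \<mu> (a \<otimes>\<^sub>o\<^bsub>T\<^esub> b) c \<cdot>\<^bsub>S\<^esub> (\<mu> a b \<otimes>\<^sub>a\<^bsub>S\<^esub> Ident S (FO F c)) =
        \<mu> a (b \<otimes>\<^sub>o\<^bsub>T\<^esub> c) \<cdot>\<^bsub>S\<^esub> (Ident S (FO F a) \<otimes>\<^sub>a\<^bsub>S\<^esub> \<mu> b c) \<cdot>\<^bsub>S\<^esub>
          Assoc S (FO F a) (FO F b) (FO F c)) \<and>
      (\<forall>a \<in> Ob T.
        FA F (LUnit T a) \<cdot>\<^bsub>S\<^esub> \<mu> (UnitO T) a \<cdot>\<^bsub>S\<^esub> (\<eta> \<otimes>\<^sub>a\<^bsub>S\<^esub> Ident S (FO F a)) = LUnit S (FO F a) \<and>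
        FA F (RUnit T a) \<cdot>\<^bsub>S\<^esub> \<mu> a (UnitO T) \<cdot>\<^bsub>S\<^esub> (Ident S (FO F a) \<otimes>\<^sub>a\<^bsub>S\<^esub> \<eta>) = RUnit S (FO F a)))"

definition geometric_functor ::
    "'u set \<Rightarrow> ('o, 'm, 'z) ttcat_scheme \<Rightarrow> ('p, 'n, 'y) ttcat_scheme \<Rightarrow>
     ('o, 'm, 'p, 'n) cfunctor \<Rightarrow> bool"
  where "geometric_functor U T S F \<longleftrightarrow>
    strong_monoidal_functor T S F \<and> exact_functor T S F \<and> preserves_coproducts U T S F"


section \<open>Purity and pure descendability\<close>

definition pure_mono ::
    "'u set \<Rightarrow> ('o, 'm, 'z) triangulated_scheme \<Rightarrow> 'o \<Rightarrow> 'o \<Rightarrow> 'm \<Rightarrow> bool"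
  where "pure_mono U T x y g \<longleftrightarrow> g \<in> Hom T x y \<and>
    (\<forall>c. compact_object U T c \<longrightarrow> inj_on (\<lambda>f. g \<cdot>\<^bsub>T\<^esub> f) (Hom T c x))"

inductive_set pure_closure :: "'u set \<Rightarrow> ('o, 'm, 'z) triangulated_scheme \<Rightarrow> 'o set \<Rightarrow> 'o set"
  for U :: "'u set" and T :: "('o, 'm, 'z) triangulated_scheme" and X :: "'o set" where
  base: "x \<in> X \<Longrightarrow> x \<in> pure_closure U T X"
| subobject: "y \<in> pure_closure U T X \<Longrightarrow> pure_mono U T x y g \<Longrightarrow> x \<in> pure_closure U T X"

inductive_set prod_closure :: "'u set \<Rightarrow> ('o, 'm, 'z) triangulated_scheme \<Rightarrow> 'o set \<Rightarrow> 'o set"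
  for U :: "'u set" and T :: "('o, 'm, 'z) triangulated_scheme" and X :: "'o set" where
  base: "x \<in> X \<Longrightarrow> x \<in> prod_closure U T X"
| product: "K \<subseteq> U \<Longrightarrow> small U K \<Longrightarrow> (\<forall>k \<in> K. x k \<in> prod_closure U T X) \<Longrightarrow>
    is_product T K x p \<pi> \<Longrightarrow> p \<in> prod_closure U T X"

definition pure_thick_prod ::
    "'u set \<Rightarrow> ('o, 'm, 'z) triangulated_scheme \<Rightarrow> 'o set \<Rightarrow> 'o set"
  where "pure_thick_prod U T X = pure_closure U T (Thick T (prod_closure U T X))"

text \<open>
  The essential image \<open>f\<^sub>* S\<close> for a geometric functor \<open>f\<^sup>* : T \<rightarrow> S\<close>. The right adjoint exists by Brown
  representability and is unique up to isomorphism, so all right adjoints contribute the same objects.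
\<close>

definition pushforward_image ::
    "('o, 'm, 'z) ttcat_scheme \<Rightarrow> ('p, 'n, 'y) ttcat_scheme \<Rightarrow>
     ('o, 'm, 'p, 'n) cfunctor \<Rightarrow> 'o set"
  where "pushforward_image T S F = (\<Union>R \<in> {R. right_adjoint T S F R}. essential_image S T R)"

definition pure_descendable ::
    "'u set \<Rightarrow> ('o, 'm, 'z) ttcat_scheme \<Rightarrow> 'i set \<Rightarrow> ('i \<Rightarrow> ('p, 'n, 'y) ttcat_scheme) \<Rightarrow>
     ('i \<Rightarrow> ('o, 'm, 'p, 'n) cfunctor) \<Rightarrow> bool"
  where "pure_descendable U T I S F \<longleftrightarrow>
    pure_thick_prod U T (\<Union>i \<in> I. pushforward_image T (S i) (F i)) = Ob T"

end

theory Submission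
  imports Defs
begin

text \<open>
  Let \<open>Z\<close> be the class of objects that all the functors \<open>f\<^sub>i\<^sup>*\<close> send to zero, and let \<open>P\<close> be its right
  orthogonal, the class of all \<open>y\<close> with \<open>Hom(a, y) = 0\<close> for every \<open>a \<in> Z\<close>. The adjunction
  \<open>Hom(a, f\<^sub>* s) \<cong> Hom(f\<^sup>* a, s)\<close> puts every object of the form \<open>f\<^sub>* s\<close> into \<open>P\<close>. Every right orthogonal is
  closed under products, and this one is a thick subcategory because \<open>Z\<close> is stable under the shift in
  both directions (lemma \<open>thick_right_orthogonal\<close>). Thus \<open>P\<close> contains
  \<open>Thick(prod(\<Union>\<^sub>i (f\<^sub>i)\<^sub>* S\<^sub>i))\<close>.

  In general \<open>P\<close> is not closed under pure subobjects, since the objects of \<open>Z\<close> need not be compact, so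
  one cannot conclude that \<open>P\<close> is everything. Instead, pure descendability gives each \<open>x \<in> Z\<close> a pure monomorphism into some \<open>y \<in> P\<close>. This map is zero
  by orthogonality and yet injective on maps out of compact objects, so no nonzero map from a compact
  object reaches \<open>x\<close>. As this applies to all positive and negative shifts of \<open>x\<close> too, compact
  generation yields \<open>x = 0\<close>. The other implication holds because additive functors preserve zero
  objects.
\<close>

section \<open>Zero morphisms and zero objects\<close>

context category
begin

lemma Hom_Ob: "f \<in> Hom C a b \<Longrightarrow> a \<in> Ob C \<and> b \<in> Ob C"
  using Dom_Ob Cod_Ob by (auto simp: Hom_def)

lemma isomorphic_inverses:
  assumes "isomorphic C a b"
  obtains u v where "u \<in> Hom C a b" "v \<in> Hom C b a" "v \<cdot> u = Ident C a" "u \<cdot> v = Ident C b"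
  using assms by (auto simp: isomorphic_def Iso_def)

lemma isomorphic_sym: "isomorphic C a b \<Longrightarrow> isomorphic C b a"
  by (auto simp: isomorphic_def Iso_def)

end

lemma isomorphic_functor_image:
  assumes "category C" "is_functor C D F" "isomorphic C a b"
  shows "isomorphic D (FO F a) (FO F b)"
proof -
  interpret category C by fact
  obtain u v where uv: "u \<in> Hom C a b" "v \<in> Hom C b a"
      "v \<cdot>\<^bsub>C\<^esub> u = Ident C a" "u \<cdot>\<^bsub>C\<^esub> v = Ident C b"
    using isomorphic_inverses[OF assms(3)] .
  have ob: "a \<in> Ob C" "b \<in> Ob C" using uv Hom_Ob by auto
  have "FA F u \<in> Hom D (FO F a) (FO F b)" "FA F v \<in> Hom D (FO F b) (FO F a)"
    using assms(2) uv by (auto simp: is_functor_def)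
  moreover have "FA F v \<cdot>\<^bsub>D\<^esub> FA F u = Ident D (FO F a)"
    using assms(2) uv ob unfolding is_functor_def by metis
  moreover have "FA F u \<cdot>\<^bsub>D\<^esub> FA F v = Ident D (FO F b)"
    using assms(2) uv ob unfolding is_functor_def by metis
  ultimately show ?thesis by (auto simp: isomorphic_def Iso_def)
qed

context additive_category
begin

lemma ZeroA_Hom: "a \<in> Ob A \<Longrightarrow> b \<in> Ob A \<Longrightarrow> ZeroA A a b \<in> Hom A a b"
  using hom_comm_group[of a b] comm_groupE(2)[of "hom_group A a b"] by (simp add: hom_group_def)

lemma ZeroA_add: "f \<in> Hom A a b \<Longrightarrow> ZeroA A a b \<^bold>+ f = f"
  using hom_comm_group[of a b] comm_groupE(5)[of "hom_group A a b" f] Hom_Ob[of f a b]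
  by (simp add: hom_group_def)

lemma add_idem_ZeroA:
  assumes "f \<in> Hom A a b" "f \<^bold>+ f = f"
  shows "f = ZeroA A a b"
proof -
  interpret G: comm_group "hom_group A a b" using hom_comm_group Hom_Ob[OF assms(1)] by blast
  show ?thesis using G.r_cancel_one[of f f] assms by (simp add: hom_group_def)
qed

lemma Comp_ZeroA_right:
  assumes "f \<in> Hom A b c" "a \<in> Ob A"
  shows "f \<cdot> ZeroA A a b = ZeroA A a c"
proof -
  have z: "ZeroA A a b \<in> Hom A a b" using ZeroA_Hom Hom_Ob assms by blast
  show ?thesis
    using Comp_add_right[OF z z assms(1)] ZeroA_add[OF z] Comp_Hom[OF z assms(1)] add_idem_ZeroA
    by simp
qed

lemma Comp_ZeroA_left:
  assumes "f \<in> Hom A a b" "c \<in> Ob A"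
  shows "ZeroA A b c \<cdot> f = ZeroA A a c"
proof -
  have z: "ZeroA A b c \<in> Hom A b c" using ZeroA_Hom Hom_Ob assms by blast
  show ?thesis
    using Comp_add_left[OF assms(1) z z] ZeroA_add[OF z] Comp_Hom[OF assms(1) z] add_idem_ZeroA
    by simp
qed

lemma zero_object_Hom_from: "zero_object A z \<Longrightarrow> b \<in> Ob A \<Longrightarrow> f \<in> Hom A z b \<Longrightarrow> f = ZeroA A z b"
  using ZeroA_Hom[of z b] by (auto simp: zero_object_def)

lemma zero_object_Hom_to: "zero_object A z \<Longrightarrow> b \<in> Ob A \<Longrightarrow> f \<in> Hom A b z \<Longrightarrow> f = ZeroA A b z"
  using ZeroA_Hom[of b z] by (auto simp: zero_object_def)

text \<open>
  This characterization is an equation between morphisms, so it passes through additive functors and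
  can be cancelled by faithful ones.
\<close>

lemma zero_object_iff_Ident: "zero_object A z \<longleftrightarrow> z \<in> Ob A \<and> Ident A z = ZeroA A z z"
proof
  assume z: "zero_object A z"
  then have "z \<in> Ob A" by (simp add: zero_object_def)
  with z show "z \<in> Ob A \<and> Ident A z = ZeroA A z z" using zero_object_Hom_from Ident_Hom by blast
next
  assume z: "z \<in> Ob A \<and> Ident A z = ZeroA A z z"
  have "f = ZeroA A z x" if "f \<in> Hom A z x" for f x
    using Ident_right[OF that] Comp_ZeroA_right[OF that] z by auto
  moreover have "f = ZeroA A x z" if "f \<in> Hom A x z" for f x
    using Ident_left[OF that] Comp_ZeroA_left[OF that] z by auto
  ultimately show "zero_object A z" using z ZeroA_Hom unfolding zero_object_def by metis
qed

lemma zero_object_isomorphic: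
  assumes "zero_object A a" "isomorphic A a b"
  shows "zero_object A b"
proof -
  obtain u v where uv: "u \<in> Hom A a b" "v \<in> Hom A b a" "u \<cdot> v = Ident A b"
    using isomorphic_inverses[OF assms(2)] by metis
  then have "u = ZeroA A a b" and ob: "b \<in> Ob A"
    using assms(1) zero_object_Hom_from Hom_Ob by blast+
  then show ?thesis using uv Comp_ZeroA_left[OF uv(2) ob] by (simp add: zero_object_iff_Ident)
qed

end

lemma additive_functor_ZeroA:
  assumes "additive_category C" "additive_category D" "additive_functor C D F" "a \<in> Ob C" "b \<in> Ob C"
  shows "FA F (ZeroA C a b) = ZeroA D (FO F a) (FO F b)"
proof -
  interpret C: additive_category C by fact
  interpret D: additive_category D by fact
  have z: "ZeroA C a b \<in> Hom C a b" using C.ZeroA_Hom assms by blast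
  have "FA F (ZeroA C a b) \<in> Hom D (FO F a) (FO F b)"
    using z assms(3) by (auto simp: additive_functor_def is_functor_def)
  moreover have "FA F (ZeroA C a b) \<^bold>+\<^bsub>D\<^esub> FA F (ZeroA C a b) = FA F (ZeroA C a b)"
    using assms(3) z C.ZeroA_add[OF z] unfolding additive_functor_def by metis
  ultimately show ?thesis by (rule D.add_idem_ZeroA)
qed

lemma additive_functor_zero_object:
  assumes "additive_category C" "additive_category D" "additive_functor C D F" "zero_object C z"
  shows "zero_object D (FO F z)"
proof -
  interpret C: additive_category C by fact
  interpret D: additive_category D by fact
  have z: "z \<in> Ob C" "Ident C z = ZeroA C z z" using assms(4) C.zero_object_iff_Ident by auto
  have "FO F z \<in> Ob D" "FA F (Ident C z) = Ident D (FO F z)"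
    using assms(3) z by (auto simp: additive_functor_def is_functor_def)
  then show ?thesis
    using z additive_functor_ZeroA[OF assms(1-3) z(1) z(1)] D.zero_object_iff_Ident by simp
qed

section \<open>Orthogonality in triangulated categories\<close>

text \<open>
  Stability in the negative direction is phrased by a preimage up to isomorphism, since the shift is
  only an equivalence.
\<close>

definition shift_stable :: "('o, 'm, 'z) triangulated_scheme \<Rightarrow> 'o set \<Rightarrow> bool"
  where "shift_stable T Z \<longleftrightarrow> Z \<subseteq> Ob T \<and> (\<forall>a \<in> Z. FO (Shift T) a \<in> Z) \<and>
    (\<forall>a \<in> Z. \<exists>b \<in> Z. isomorphic T (FO (Shift T) b) a)"

definition right_orthogonal :: "('o, 'm, 'z) preadditive_scheme \<Rightarrow> 'o set \<Rightarrow> 'o set"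
  where "right_orthogonal T Z = {y \<in> Ob T. \<forall>a \<in> Z. Hom T a y \<subseteq> {ZeroA T a y}}"

context additive_category
begin

lemma ZeroA_if_Comp_iso_ZeroA:
  assumes "f \<in> Hom A a b" "u \<in> Hom A c a" "v \<in> Hom A a c" "u \<cdot> v = Ident A a"
    and "f \<cdot> u = ZeroA A c b"
  shows "f = ZeroA A a b"
proof -
  have "f = (f \<cdot> u) \<cdot> v" using Comp_assoc[OF assms(3,2,1)] assms Ident_right by simp
  then show ?thesis using assms Comp_ZeroA_left Hom_Ob by metis
qed

lemma right_orthogonal_retract:
  assumes "y \<in> right_orthogonal A Z" "i \<in> Hom A x y" "r \<in> Hom A y x" "r \<cdot> i = Ident A x"
  shows "x \<in> right_orthogonal A Z"
proof -
  have "f = ZeroA A a x" if "a \<in> Z" "f \<in> Hom A a x" for a f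
  proof -
    have "i \<cdot> f = ZeroA A a y"
      using assms that Comp_Hom[OF that(2) assms(2)] by (auto simp: right_orthogonal_def)
    moreover have "f = r \<cdot> (i \<cdot> f)"
      using Comp_assoc[OF that(2) assms(2,3)] assms(4) Ident_left[OF that(2)] by simp
    ultimately show ?thesis using Comp_ZeroA_right[OF assms(3)] Hom_Ob[OF that(2)] by simp
  qed
  then show ?thesis using Hom_Ob[OF assms(2)] by (auto simp: right_orthogonal_def)
qed

lemma right_orthogonal_isomorphic:
  assumes "y \<in> right_orthogonal A Z" "isomorphic A y x"
  shows "x \<in> right_orthogonal A Z"
  using assms isomorphic_inverses right_orthogonal_retract by metis

lemma right_orthogonal_product:
  assumes "is_product A K x p \<pi>" "\<And>k. k \<in> K \<Longrightarrow> x k \<in> right_orthogonal A Z"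
  shows "p \<in> right_orthogonal A Z"
proof -
  have p: "p \<in> Ob A" "\<And>k. k \<in> K \<Longrightarrow> x k \<in> Ob A \<and> \<pi> k \<in> Hom A p (x k)"
    using assms(1) by (auto simp: is_product_def)
  have "f = ZeroA A a p" if a: "a \<in> Z" and f: "f \<in> Hom A a p" for a f
  proof -
    have ob: "a \<in> Ob A" using Hom_Ob f by blast
    have "\<exists>!h. h \<in> Hom A a p \<and> (\<forall>k \<in> K. \<pi> k \<cdot> h = ZeroA A a (x k))"
      using assms(1) ob p(2) ZeroA_Hom unfolding is_product_def by simp
    moreover have "\<forall>k \<in> K. \<pi> k \<cdot> f = ZeroA A a (x k)"
    proof
      fix k assume k: "k \<in> K"
      have "\<pi> k \<cdot> f \<in> Hom A a (x k)" using Comp_Hom[OF f] p(2)[OF k] by blast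
      with assms(2)[OF k] a show "\<pi> k \<cdot> f = ZeroA A a (x k)" by (auto simp: right_orthogonal_def)
    qed
    moreover have "\<forall>k \<in> K. \<pi> k \<cdot> ZeroA A a p = ZeroA A a (x k)"
      using Comp_ZeroA_right p(2) ob by blast
    ultimately show ?thesis using f ZeroA_Hom[OF ob p(1)] by blast
  qed
  then show ?thesis using p(1) by (auto simp: right_orthogonal_def)
qed

end

context triangulated_category
begin

abbreviation "\<Sigma>o \<equiv> FO (Shift T)"
abbreviation "\<Sigma>a \<equiv> FA (Shift T)"

lemma shift_Ob: "a \<in> Ob T \<Longrightarrow> \<Sigma>o a \<in> Ob T"
  using shift_equivalence by (simp add: is_equivalence_def is_functor_def)

lemma shift_Hom: "f \<in> Hom T a b \<Longrightarrow> \<Sigma>a f \<in> Hom T (\<Sigma>o a) (\<Sigma>o b)"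
  using shift_equivalence by (simp add: is_equivalence_def is_functor_def)

lemma shift_bij: "a \<in> Ob T \<Longrightarrow> b \<in> Ob T \<Longrightarrow> bij_betw \<Sigma>a (Hom T a b) (Hom T (\<Sigma>o a) (\<Sigma>o b))"
  using shift_equivalence by (simp add: is_equivalence_def)

lemma shift_ZeroA: "a \<in> Ob T \<Longrightarrow> b \<in> Ob T \<Longrightarrow> \<Sigma>a (ZeroA T a b) = ZeroA T (\<Sigma>o a) (\<Sigma>o b)"
  using additive_functor_ZeroA[OF additive_category_axioms additive_category_axioms shift_additive] .

lemma shift_ZeroA_cancel:
  assumes "f \<in> Hom T a b" "\<Sigma>a f = ZeroA T (\<Sigma>o a) (\<Sigma>o b)"
  shows "f = ZeroA T a b"
proof -
  have ob: "a \<in> Ob T" "b \<in> Ob T" using Hom_Ob assms by auto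
  show ?thesis
    using bij_betw_imp_inj_on[OF shift_bij[OF ob]] assms shift_ZeroA[OF ob] ZeroA_Hom[OF ob]
    by (metis inj_onD)
qed

lemma shift_Hom_ZeroA:
  assumes "a \<in> Ob T" "b \<in> Ob T" "Hom T a b \<subseteq> {ZeroA T a b}"
  shows "Hom T (\<Sigma>o a) (\<Sigma>o b) \<subseteq> {ZeroA T (\<Sigma>o a) (\<Sigma>o b)}"
proof -
  have "Hom T (\<Sigma>o a) (\<Sigma>o b) = \<Sigma>a ` Hom T a b"
    using shift_bij[OF assms(1,2)] by (simp add: bij_betw_def)
  then show ?thesis using assms shift_ZeroA by auto
qed

lemma zero_object_shift_iff:
  assumes "a \<in> Ob T"
  shows "zero_object T (\<Sigma>o a) \<longleftrightarrow> zero_object T a"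
proof
  have id: "\<Sigma>a (Ident T a) = Ident T (\<Sigma>o a)"
    using shift_equivalence assms by (simp add: is_equivalence_def is_functor_def)
  assume "zero_object T (\<Sigma>o a)"
  then have "\<Sigma>a (Ident T a) = ZeroA T (\<Sigma>o a) (\<Sigma>o a)" using id zero_object_iff_Ident by simp
  then show "zero_object T a" using assms shift_ZeroA_cancel Ident_Hom zero_object_iff_Ident by blast
next
  assume "zero_object T a"
  then show "zero_object T (\<Sigma>o a)"
    using additive_functor_zero_object[OF additive_category_axioms additive_category_axioms
        shift_additive] by blast
qed

lemma right_orthogonal_shift_iff:
  assumes Z: "shift_stable T Z" and y: "y \<in> Ob T"
  shows "\<Sigma>o y \<in> right_orthogonal T Z \<longleftrightarrow> y \<in> right_orthogonal T Z"
proof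
  assume P: "\<Sigma>o y \<in> right_orthogonal T Z"
  have "f = ZeroA T a y" if "a \<in> Z" "f \<in> Hom T a y" for a f
  proof -
    have "\<Sigma>o a \<in> Z" using Z that by (auto simp: shift_stable_def)
    then have "\<Sigma>a f = ZeroA T (\<Sigma>o a) (\<Sigma>o y)"
      using P shift_Hom[OF that(2)] by (auto simp: right_orthogonal_def)
    then show ?thesis using shift_ZeroA_cancel[OF that(2)] by blast
  qed
  then show "y \<in> right_orthogonal T Z" using y by (auto simp: right_orthogonal_def)
next
  assume P: "y \<in> right_orthogonal T Z"
  have "f = ZeroA T a (\<Sigma>o y)" if a: "a \<in> Z" and f: "f \<in> Hom T a (\<Sigma>o y)" for a f
  proof -
    obtain b where b: "b \<in> Z" "isomorphic T (\<Sigma>o b) a"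
      using Z a by (auto simp: shift_stable_def)
    then obtain u v where uv: "u \<in> Hom T (\<Sigma>o b) a" "v \<in> Hom T a (\<Sigma>o b)" "u \<cdot> v = Ident T a"
      using isomorphic_inverses by metis
    have "b \<in> Ob T" "Hom T b y \<subseteq> {ZeroA T b y}"
      using b Z P by (auto simp: shift_stable_def right_orthogonal_def)
    then have "f \<cdot> u = ZeroA T (\<Sigma>o b) (\<Sigma>o y)"
      using shift_Hom_ZeroA y Comp_Hom[OF uv(1) f] by blast
    then show ?thesis using ZeroA_if_Comp_iso_ZeroA[OF f uv] by blast
  qed
  then show "\<Sigma>o y \<in> right_orthogonal T Z" using shift_Ob[OF y] by (auto simp: right_orthogonal_def)
qed

lemma dist_triangle_rotate:
  assumes "dist_triangle T x y z f g h"
  shows "dist_triangle T y z (\<Sigma>o x) g h (inv\<^bsub>hom_group T (\<Sigma>o x) (\<Sigma>o y)\<^esub> (\<Sigma>a f))"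
  using assms TR2 unfolding dist_triangle_def by blast

text \<open>
  The exactness of \<open>Hom(a, x) \<rightarrow> Hom(a, y) \<rightarrow> Hom(a, z)\<close> lies behind this: a map \<open>u : a \<rightarrow> y\<close> dies in \<open>z\<close>,
  so it extends to a map from the rotation of the triangle \<open>a \<rightarrow> a \<rightarrow> 0 \<rightarrow> \<Sigma> a\<close> to the rotation of the
  given one. Its third component \<open>\<Sigma> a \<rightarrow> \<Sigma> x\<close> vanishes by orthogonality, and then so does \<open>\<Sigma> u\<close>.
\<close>

lemma right_orthogonal_extension:
  assumes Z: "shift_stable T Z" and tri: "dist_triangle T x y z f g h"
    and x: "x \<in> right_orthogonal T Z" and z: "z \<in> right_orthogonal T Z"
  shows "y \<in> right_orthogonal T Z"
proof -
  have fgh: "f \<in> Hom T x y" "g \<in> Hom T y z" "h \<in> Hom T z (\<Sigma>o x)"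
    using tri by (auto simp: dist_triangle_def triangle_def)
  then have ob: "x \<in> Ob T" "y \<in> Ob T" "z \<in> Ob T" using Hom_Ob by auto
  have "u = ZeroA T a y" if aZ: "a \<in> Z" and u: "u \<in> Hom T a y" for a u
  proof -
    have a: "a \<in> Ob T" using Hom_Ob u by blast
    obtain o0 where o0: "zero_object T o0" using zero_object_exists by blast
    then have o0_Ob: "o0 \<in> Ob T" by (simp add: zero_object_def)
    let ?n = "inv\<^bsub>hom_group T (\<Sigma>o a) (\<Sigma>o a)\<^esub> (\<Sigma>a (Ident T a))"
    let ?f' = "inv\<^bsub>hom_group T (\<Sigma>o x) (\<Sigma>o y)\<^esub> (\<Sigma>a f)"
    have tri_a: "dist_triangle T a o0 (\<Sigma>o a) (ZeroA T a o0) (ZeroA T o0 (\<Sigma>o a)) ?n"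
      using dist_triangle_rotate[OF TR1_ident[OF a o0]] .
    have tri_x: "dist_triangle T y z (\<Sigma>o x) g h ?f'"
      using dist_triangle_rotate[OF tri] .
    have "g \<cdot> u = ZeroA T a z" using z aZ Comp_Hom[OF u fgh(2)] by (auto simp: right_orthogonal_def)
    then have "g \<cdot> u = ZeroA T o0 z \<cdot> ZeroA T a o0"
      using Comp_ZeroA_left[OF ZeroA_Hom[OF a o0_Ob] ob(3)] by simp
    then obtain c where c: "c \<in> Hom T (\<Sigma>o a) (\<Sigma>o x)" "?f' \<cdot> c = \<Sigma>a u \<cdot> ?n"
      using TR3[OF tri_a tri_x u ZeroA_Hom[OF o0_Ob ob(3)]] by blast
    have "\<Sigma>o x \<in> right_orthogonal T Z" "\<Sigma>o a \<in> Z"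
      using right_orthogonal_shift_iff[OF Z ob(1)] x Z aZ by (auto simp: shift_stable_def)
    then have "c = ZeroA T (\<Sigma>o a) (\<Sigma>o x)" using c(1) by (auto simp: right_orthogonal_def)
    moreover have "?f' \<in> Hom T (\<Sigma>o x) (\<Sigma>o y)"
      using tri_x by (simp add: dist_triangle_def triangle_def)
    ultimately have u_n: "\<Sigma>a u \<cdot> ?n = ZeroA T (\<Sigma>o a) (\<Sigma>o y)"
      using c(2) Comp_ZeroA_right shift_Ob[OF a] by simp
    interpret G: comm_group "hom_group T (\<Sigma>o a) (\<Sigma>o a)"
      using hom_comm_group shift_Ob[OF a] by blast
    have id: "Ident T (\<Sigma>o a) \<in> Hom T (\<Sigma>o a) (\<Sigma>o a)" "\<Sigma>a (Ident T a) = Ident T (\<Sigma>o a)"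
      using Ident_Hom shift_Ob[OF a] shift_equivalence a
      by (auto simp: is_equivalence_def is_functor_def)
    have n: "?n \<in> Hom T (\<Sigma>o a) (\<Sigma>o a)"
      using tri_a by (simp add: dist_triangle_def triangle_def)
    have Su: "\<Sigma>a u \<in> Hom T (\<Sigma>o a) (\<Sigma>o y)" by (rule shift_Hom[OF u])
    have "?n \<^bold>+ Ident T (\<Sigma>o a) = ZeroA T (\<Sigma>o a) (\<Sigma>o a)"
      using G.l_inv[of "Ident T (\<Sigma>o a)"] id by (simp add: hom_group_def)
    (* Multiplying out \<Sigma>u (-1 + 1) = 0 removes the sign that the rotation has brought in. *)
    then have "(\<Sigma>a u \<cdot> ?n) \<^bold>+ \<Sigma>a u = ZeroA T (\<Sigma>o a) (\<Sigma>o y)"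
      using Comp_add_right[OF n id(1) Su] Ident_right[OF Su]
        Comp_ZeroA_right[OF Su shift_Ob[OF a]] by simp
    then have "\<Sigma>a u = ZeroA T (\<Sigma>o a) (\<Sigma>o y)" using u_n ZeroA_add[OF Su] by simp
    then show ?thesis by (rule shift_ZeroA_cancel[OF u])
  qed
  then show ?thesis using ob by (auto simp: right_orthogonal_def)
qed

text \<open>
  Closure under extensions suffices for the two-out-of-three property: rotation moves every term of a
  triangle to the middle, up to shifts that the right orthogonal does not see.
\<close>

lemma thick_right_orthogonal:
  assumes Z: "shift_stable T Z"
  shows "thick_subcategory T (right_orthogonal T Z)"
  unfolding thick_subcategory_def
proof (intro conjI allI impI ballI)
  show "right_orthogonal T Z \<subseteq> Ob T" by (auto simp: right_orthogonal_def)
next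
  fix z assume z: "zero_object T z"
  have "f = ZeroA T a z" if "f \<in> Hom T a z" for a f
    using zero_object_Hom_to[OF z _ that] Hom_Ob[OF that] by blast
  moreover have "z \<in> Ob T" using z by (simp add: zero_object_def)
  ultimately show "z \<in> right_orthogonal T Z" by (auto simp: right_orthogonal_def)
next
  fix x assume "x \<in> Ob T"
  then show "\<Sigma>o x \<in> right_orthogonal T Z \<longleftrightarrow> x \<in> right_orthogonal T Z"
    by (rule right_orthogonal_shift_iff[OF Z])
next
  fix x y z f g h
  assume tri: "dist_triangle T x y z f g h"
  note tri' = dist_triangle_rotate[OF tri]
  have ob: "x \<in> Ob T" "y \<in> Ob T" "z \<in> Ob T"
    using tri Hom_Ob[of f x y] Hom_Ob[of g y z] unfolding dist_triangle_def triangle_def by simp_all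
  show "z \<in> right_orthogonal T Z" if "x \<in> right_orthogonal T Z \<and> y \<in> right_orthogonal T Z"
    using right_orthogonal_extension[OF Z tri'] right_orthogonal_shift_iff[OF Z ob(1)] that by blast
  show "x \<in> right_orthogonal T Z" if "y \<in> right_orthogonal T Z \<and> z \<in> right_orthogonal T Z"
    using right_orthogonal_extension[OF Z dist_triangle_rotate[OF tri']]
      right_orthogonal_shift_iff[OF Z ob(1)] right_orthogonal_shift_iff[OF Z ob(2)] that by blast
  show "y \<in> right_orthogonal T Z" if "x \<in> right_orthogonal T Z \<and> z \<in> right_orthogonal T Z"
    using right_orthogonal_extension[OF Z tri] that by blast
next
  fix x y i r
  assume "y \<in> right_orthogonal T Z" "i \<in> Hom T x y" "r \<in> Hom T y x" "r \<cdot> i = Ident T x"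
  then show "x \<in> right_orthogonal T Z" by (rule right_orthogonal_retract)
qed

lemma Thick_prod_closure_right_orthogonal:
  assumes "shift_stable T Z" "X \<subseteq> right_orthogonal T Z"
  shows "Thick T (prod_closure U T X) \<subseteq> right_orthogonal T Z"
proof -
  have "y \<in> right_orthogonal T Z" if "y \<in> prod_closure U T X" for y
    using that
  proof induction
    case (base x)
    then show ?case using assms(2) by blast
  next
    case (product K x p \<pi>)
    then show ?case using right_orthogonal_product[of K x p \<pi> Z] by blast
  qed
  then show ?thesis using thick_right_orthogonal[OF assms(1)] unfolding Thick_def by blast
qed

section \<open>Pure subobjects and compact generation\<close>

lemma pure_mono_Ident:
  assumes "x \<in> Ob T"
  shows "pure_mono U T x x (Ident T x)"
  using Ident_Hom[OF assms] by (auto intro!: inj_onI simp: pure_mono_def Ident_left)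

text \<open>Pure monomorphisms compose, so the inductive closure is reached in a single step.\<close>

lemma pure_closure_pure_mono:
  assumes "x \<in> pure_closure U T X" "X \<subseteq> Ob T"
  shows "\<exists>y \<in> X. \<exists>g. pure_mono U T x y g"
  using assms(1)
proof induction
  case (base x)
  then show ?case using pure_mono_Ident assms(2) by blast
next
  case (subobject y x g)
  then obtain w k where w: "w \<in> X" and k: "pure_mono U T y w k" by blast
  have gk: "g \<in> Hom T x y" "k \<in> Hom T y w"
    using subobject k by (auto simp: pure_mono_def)
  have "inj_on (\<lambda>f. (k \<cdot> g) \<cdot> f) (Hom T c x)" if c: "compact_object U T c" for c
  proof (rule inj_onI)
    fix f f' assume f: "f \<in> Hom T c x" "f' \<in> Hom T c x" and "(k \<cdot> g) \<cdot> f = (k \<cdot> g) \<cdot> f'"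
    then have eq: "k \<cdot> (g \<cdot> f) = k \<cdot> (g \<cdot> f')"
      using Comp_assoc[OF f(1) gk] Comp_assoc[OF f(2) gk] by simp
    have inj: "inj_on ((\<cdot>) k) (Hom T c y)" "inj_on ((\<cdot>) g) (Hom T c x)"
      using subobject(2) k c by (auto simp: pure_mono_def)
    have "g \<cdot> f = g \<cdot> f'"
      using inj_onD[OF inj(1) eq] Comp_Hom[OF f(1) gk(1)] Comp_Hom[OF f(2) gk(1)] by blast
    then show "f = f'" using inj_onD[OF inj(2)] f by blast
  qed
  then have "pure_mono U T x w (k \<cdot> g)" using Comp_Hom[OF gk] by (simp add: pure_mono_def)
  with w show ?case by blast
qed

text \<open>The pure monomorphism \<open>g\<close> is itself a map from \<open>Z\<close> to its right orthogonal, hence zero.\<close>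

lemma compact_Hom_ZeroA_if_pure_sub_orthogonal:
  assumes "x \<in> Z" "y \<in> right_orthogonal T Z" "pure_mono U T x y g" "compact_object U T c"
  shows "Hom T c x \<subseteq> {ZeroA T c x}"
proof
  fix f assume f: "f \<in> Hom T c x"
  have g: "g \<in> Hom T x y" "inj_on (\<lambda>f. g \<cdot> f) (Hom T c x)"
    using assms by (auto simp: pure_mono_def)
  have g0: "g = ZeroA T x y" using g assms by (auto simp: right_orthogonal_def)
  have ob: "c \<in> Ob T" "x \<in> Ob T" "y \<in> Ob T" using Hom_Ob f g(1) by blast+
  have "g \<cdot> f = g \<cdot> ZeroA T c x"
    using g0 Comp_ZeroA_left[OF f ob(3)] Comp_ZeroA_right[OF g(1) ob(1)] by simp
  then show "f \<in> {ZeroA T c x}" using inj_onD[OF g(2)] f ZeroA_Hom[OF ob(1,2)] by blast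
qed

text \<open>
  Maps out of the shifts \<open>\<Sigma>\<^sup>n g\<close> of a generator are traded for maps out of \<open>g\<close> into negative shifts of
  \<open>x\<close>, which remain in \<open>Z\<close>. This way compactness of \<open>g\<close> itself is enough, and nothing has to be known
  about how the shift acts on compact objects.
\<close>

lemma zero_object_if_compact_Hom_ZeroA:
  assumes cg: "compactly_generated U T" and Z: "shift_stable T Z"
    and orth: "\<And>c x. compact_object U T c \<Longrightarrow> x \<in> Z \<Longrightarrow> Hom T c x \<subseteq> {ZeroA T c x}"
    and x: "x \<in> Z"
  shows "zero_object T x"
proof -
  obtain G where G: "\<And>g. g \<in> G \<Longrightarrow> compact_object U T g"
    and gen: "\<And>x. x \<in> Ob T \<Longrightarrow>
        (\<And>g n. g \<in> G \<Longrightarrow> Hom T ((\<Sigma>o ^^ n) g) x = {ZeroA T ((\<Sigma>o ^^ n) g) x} \<and>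
          Hom T g ((\<Sigma>o ^^ n) x) = {ZeroA T g ((\<Sigma>o ^^ n) x)})
        \<Longrightarrow> zero_object T x"
    using cg unfolding compactly_generated_def by metis
  have Z_Ob: "Z \<subseteq> Ob T" using Z by (simp add: shift_stable_def)
  have from_shift: "(\<Sigma>o ^^ n) g \<in> Ob T \<and> (\<forall>y \<in> Z. Hom T ((\<Sigma>o ^^ n) g) y \<subseteq> {ZeroA T ((\<Sigma>o ^^ n) g) y})"
    if g: "g \<in> G" for g n
  proof (induction n)
    case 0
    then show ?case using orth[OF G[OF g]] G[OF g] by (simp add: compact_object_def)
  next
    case (Suc n)
    let ?a = "(\<Sigma>o ^^ n) g"
    have "f = ZeroA T (\<Sigma>o ?a) y" if y: "y \<in> Z" and f: "f \<in> Hom T (\<Sigma>o ?a) y" for f y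
    proof -
      obtain b where b: "b \<in> Z" "isomorphic T (\<Sigma>o b) y"
        using Z y by (auto simp: shift_stable_def)
      have bO: "b \<in> Ob T" using b Z_Ob by blast
      have "\<Sigma>o b \<in> right_orthogonal T {\<Sigma>o ?a}"
        using shift_Hom_ZeroA[of ?a b] Suc b bO shift_Ob[OF bO] by (auto simp: right_orthogonal_def)
      then have "y \<in> right_orthogonal T {\<Sigma>o ?a}" using right_orthogonal_isomorphic b by blast
      then show ?thesis using f by (auto simp: right_orthogonal_def)
    qed
    then show ?case using shift_Ob Suc by auto
  qed
  have to_shift: "(\<Sigma>o ^^ n) x \<in> Z" for n
    using x Z by (induction n) (auto simp: shift_stable_def)
  show ?thesis
  proof (rule gen)
    show xO: "x \<in> Ob T" using x Z_Ob by blast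
    fix g n assume g: "g \<in> G"
    have gO: "g \<in> Ob T" using G[OF g] by (simp add: compact_object_def)
    have "Hom T g ((\<Sigma>o ^^ n) x) = {ZeroA T g ((\<Sigma>o ^^ n) x)}"
      using orth[OF G[OF g] to_shift[of n]] ZeroA_Hom[OF gO] to_shift[of n] Z_Ob by blast
    moreover have "Hom T ((\<Sigma>o ^^ n) g) x = {ZeroA T ((\<Sigma>o ^^ n) g) x}"
      using from_shift[OF g, of n] x xO ZeroA_Hom by blast
    ultimately show "Hom T ((\<Sigma>o ^^ n) g) x = {ZeroA T ((\<Sigma>o ^^ n) g) x} \<and>
        Hom T g ((\<Sigma>o ^^ n) x) = {ZeroA T g ((\<Sigma>o ^^ n) x)}" by blast
  qed
qed

end

section \<open>Kernels of exact functors and images of their right adjoints\<close>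

lemma exact_functor_zero_object_shift_iff:
  assumes "triangulated_category C" "triangulated_category D" "exact_functor C D F" "a \<in> Ob C"
  shows "zero_object D (FO F (FO (Shift C) a)) \<longleftrightarrow> zero_object D (FO F a)"
proof -
  interpret D: triangulated_category D by fact
  have "isomorphic D (FO F (FO (Shift C) a)) (FO (Shift D) (FO F a))"
    using assms(3,4) by (auto simp: exact_functor_def isomorphic_def)
  moreover have "FO F a \<in> Ob D"
    using assms(3,4) by (simp add: exact_functor_def additive_functor_def is_functor_def)
  ultimately show ?thesis
    using D.zero_object_shift_iff D.zero_object_isomorphic D.isomorphic_sym by metis
qed

lemma shift_stable_kernel:
  assumes T: "triangulated_category T"
    and S: "\<And>i. i \<in> I \<Longrightarrow> triangulated_category (S i)"
    and F: "\<And>i. i \<in> I \<Longrightarrow> exact_functor T (S i) (F i)"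
  shows "shift_stable T {a \<in> Ob T. \<forall>i \<in> I. zero_object (S i) (FO (F i) a)}"
proof -
  interpret triangulated_category T by fact
  have shift: "zero_object (S i) (FO (F i) (\<Sigma>o a)) \<longleftrightarrow> zero_object (S i) (FO (F i) a)"
    if "i \<in> I" "a \<in> Ob T" for i a
    using exact_functor_zero_object_shift_iff[OF T S[OF that(1)] F[OF that(1)] that(2)] .
  have "\<exists>b \<in> Ob T. (\<forall>i \<in> I. zero_object (S i) (FO (F i) b)) \<and> isomorphic T (\<Sigma>o b) a"
    if a: "a \<in> Ob T" and zero: "\<forall>i \<in> I. zero_object (S i) (FO (F i) a)" for a
  proof -
    obtain b where b: "b \<in> Ob T" "isomorphic T (\<Sigma>o b) a"
      using shift_equivalence a by (auto simp: is_equivalence_def)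
    have "zero_object (S i) (FO (F i) b)" if i: "i \<in> I" for i
    proof -
      interpret Si: triangulated_category "S i" by (rule S[OF i])
      have "is_functor T (S i) (F i)"
        using F[OF i] by (simp add: exact_functor_def additive_functor_def)
      then have "isomorphic (S i) (FO (F i) a) (FO (F i) (\<Sigma>o b))"
        using isomorphic_functor_image[OF category_axioms] isomorphic_sym[OF b(2)] by blast
      from Si.zero_object_isomorphic[OF _ this] show ?thesis using zero i shift[OF i b(1)] by blast
    qed
    then show ?thesis using b by blast
  qed
  then show ?thesis using shift shift_Ob unfolding shift_stable_def mem_Collect_eq by blast
qed

lemma pushforward_image_right_orthogonal:
  assumes "additive_category T" "\<And>a. a \<in> Z \<Longrightarrow> a \<in> Ob T \<and> zero_object S (FO F a)"
  shows "pushforward_image T S F \<subseteq> right_orthogonal T Z"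
proof
  interpret additive_category T by fact
  fix y assume "y \<in> pushforward_image T S F"
  then obtain R s where R: "right_adjoint T S F R" and s: "s \<in> Ob S" "isomorphic T (FO R s) y"
    by (auto simp: pushforward_image_def essential_image_def)
  have Rs: "FO R s \<in> Ob T" using R s by (simp add: right_adjoint_def is_functor_def)
  have "Hom T a (FO R s) \<subseteq> {ZeroA T a (FO R s)}" if "a \<in> Z" for a
  proof -
    have a: "a \<in> Ob T" "zero_object S (FO F a)" using assms that by auto
    have "\<exists>!h. h \<in> Hom S (FO F a) s" using a(2) s(1) by (simp add: zero_object_def)
    then obtain h where "Hom S (FO F a) s = {h}" by blast
    moreover obtain \<phi> where
        "\<forall>a \<in> Ob T. \<forall>b \<in> Ob S. bij_betw (\<phi> a b) (Hom S (FO F a) b) (Hom T a (FO R b))"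
      using R unfolding right_adjoint_def by (elim conjE exE)
    then have "bij_betw (\<phi> a s) (Hom S (FO F a) s) (Hom T a (FO R s))" using a(1) s(1) by simp
    ultimately have "Hom T a (FO R s) = {\<phi> a s h}" by (auto simp: bij_betw_def)
    then show ?thesis using ZeroA_Hom[OF a(1) Rs] by auto
  qed
  then have "FO R s \<in> right_orthogonal T Z" using Rs by (auto simp: right_orthogonal_def)
  then show "y \<in> right_orthogonal T Z" using s right_orthogonal_isomorphic by blast
qed

section \<open>Pure descendable families are jointly conservative\<close>

theorem theorem1p3:
  fixes U :: "'u set"
    and T :: "('o, 'm) ttcat"
    and I :: "'i set"
    and S :: "'i \<Rightarrow> ('p, 'n) ttcat"
    and F :: "'i \<Rightarrow> ('o, 'm, 'p, 'n) cfunctor"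
  assumes "rigidly_compactly_generated U T"
    and "\<And>i. i \<in> I \<Longrightarrow> rigidly_compactly_generated U (S i)"
    and "\<And>i. i \<in> I \<Longrightarrow> geometric_functor U T (S i) (F i)"
    and "pure_descendable U T I S F"
  shows "\<forall>x \<in> Ob T. zero_object T x \<longleftrightarrow> (\<forall>i \<in> I. zero_object (S i) (FO (F i) x))"
proof -
  have T: "triangulated_category T" and cg: "compactly_generated U T"
    using assms(1) by (auto simp: rigidly_compactly_generated_def)
  have S: "triangulated_category (S i)" if "i \<in> I" for i
    using assms(2)[OF that] by (simp add: rigidly_compactly_generated_def)
  have F: "exact_functor T (S i) (F i)" if "i \<in> I" for i
    using assms(3)[OF that] by (simp add: geometric_functor_def)
  interpret triangulated_category T by (rule T)
  define Z where "Z = {a \<in> Ob T. \<forall>i \<in> I. zero_object (S i) (FO (F i) a)}"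
  let ?X = "\<Union>i \<in> I. pushforward_image T (S i) (F i)"
  have Z: "shift_stable T Z"
    unfolding Z_def using shift_stable_kernel[OF T S F] .
  have "pushforward_image T (S i) (F i) \<subseteq> right_orthogonal T Z" if "i \<in> I" for i
    by (rule pushforward_image_right_orthogonal[OF additive_category_axioms])
      (use that in \<open>auto simp: Z_def\<close>)
  then have P: "Thick T (prod_closure U T ?X) \<subseteq> right_orthogonal T Z"
    by (intro Thick_prod_closure_right_orthogonal[OF Z]) blast
  then have P_Ob: "Thick T (prod_closure U T ?X) \<subseteq> Ob T" by (auto simp: right_orthogonal_def)
  have "Hom T c x \<subseteq> {ZeroA T c x}" if c: "compact_object U T c" and x: "x \<in> Z" for c x
  proof -
    have "x \<in> pure_closure U T (Thick T (prod_closure U T ?X))"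
      using assms(4) x by (auto simp: pure_descendable_def pure_thick_prod_def Z_def)
    then obtain y g where "y \<in> Thick T (prod_closure U T ?X)" "pure_mono U T x y g"
      using pure_closure_pure_mono[OF _ P_Ob] by blast
    then show ?thesis using compact_Hom_ZeroA_if_pure_sub_orthogonal[OF x _ _ c] P by blast
  qed
  then have zero: "zero_object T x" if "x \<in> Z" for x
    using zero_object_if_compact_Hom_ZeroA[OF cg Z] that by blast
  have "zero_object (S i) (FO (F i) x)" if i: "i \<in> I" and "zero_object T x" for i x
  proof -
    interpret Si: triangulated_category "S i" by (rule S[OF i])
    show ?thesis
      using additive_functor_zero_object[OF additive_category_axioms Si.additive_category_axioms]
        F[OF i] that(2) by (simp add: exact_functor_def)
  qed
  then show ?thesis using zero by (auto simp: Z_def)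
qed

end
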